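(* Identify $\mathbb{R}^4$, with coordinates $(q_1,q_2,q_3,q_4)$, with $\mathbb{C}^2$ via $z_1=q_1+iq_2$, $z_2=q_3+iq_4$. Let $\phi$ be a holomorphic function of $(z_1,z_2)$ (on an open subset) which is a solution of $$\phi_{12}+\overline{\phi_{12}}+|\phi_{11}|^2=0,\qquad \phi_{jk}=\frac{\partial^2\phi}{\partial z_j\partial z_k}.$$ Then the real part $f=\operatorname{Re}\phi$, viewed as a function of $(q_1,q_2,q_3,q_4)$, is a regular solution of the Plebanski II equation.
   Context: The Plebanski II equation for a function $f$ of $(q_1,q_2,q_3,q_4)$ is $$\frac{\partial^2 f}{\partial q_1^2}\frac{\partial^2 f}{\partial q_2^2}-\Big(\frac{\partial^2 f}{\partial q_1\partial q_2}\Big)^2+\frac{\partial^2 f}{\partial q_2\partial q_4}-\frac{\partial^2 f}{\partial q_1\partial q_3}=0 .$$ A regular solution is a smooth function $f$ satisfying this equation on its domain. *)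

theory Defs
  imports "HOL-Analysis.Analysis"
begin

definition partial ::
    "'n \<Rightarrow> ('a::real_normed_field ^ 'n \<Rightarrow> 'a) \<Rightarrow> 'a ^ 'n \<Rightarrow> 'a" where
  "partial i f x = deriv (\<lambda>t. f (\<chi> j. if j = i then t else x $ j)) (x $ i)"

text \<open>Complex (Frechet) differentiability at every point: the real derivative
  exists and is \<open>\<complex>\<close>-linear. Meant for open \<open>U\<close>.\<close>

definition holomorphic_vec_on :: "(complex ^ 'n \<Rightarrow> complex) \<Rightarrow> (complex ^ 'n) set \<Rightarrow> bool"
    (infixl "holomorphic'_vec'_on" 50) where
  "\<phi> holomorphic_vec_on U \<longleftrightarrow>
     (\<forall>z\<in>U. \<exists>a. (\<phi> has_derivative (\<lambda>h. \<Sum>j\<in>UNIV. a $ j * h $ j)) (at z))"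

text \<open>\<open>C_on n S f\<close>: \<open>f\<close> is \<open>n\<close> times continuously differentiable on the open set \<open>S\<close>.
  Quantifying over constant directions \<open>v\<close> avoids iterating derivatives through
  operator spaces; in finite dimension this is the usual notion.\<close>

primrec C_on :: "nat \<Rightarrow> 'a::euclidean_space set \<Rightarrow> ('a \<Rightarrow> 'b::real_normed_vector) \<Rightarrow> bool" where
  "C_on 0 S f \<longleftrightarrow> continuous_on S f"
| "C_on (Suc n) S f \<longleftrightarrow>
     (\<forall>x\<in>S. f differentiable (at x)) \<and>
     (\<forall>v. C_on n S (\<lambda>x. frechet_derivative f (at x) v))"

definition smooth_on :: "'a::euclidean_space set \<Rightarrow> ('a \<Rightarrow> 'b::real_normed_vector) \<Rightarrow> bool" where
  "smooth_on S f \<longleftrightarrow> (\<forall>n. C_on n S f)"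

definition plebanski_II_regular_solution :: "(real ^ 4 \<Rightarrow> real) \<Rightarrow> (real ^ 4) set \<Rightarrow> bool" where
  "plebanski_II_regular_solution f D \<longleftrightarrow>
     open D \<and> smooth_on D f \<and>
     (\<forall>q\<in>D. partial 1 (partial 1 f) q * partial 2 (partial 2 f) q
              - (partial 1 (partial 2 f) q)\<^sup>2
              + partial 2 (partial 4 f) q - partial 1 (partial 3 f) q = 0)"

definition to_C2 :: "real ^ 4 \<Rightarrow> complex ^ 2" where
  "to_C2 q = vector [Complex (q $ 1) (q $ 2), Complex (q $ 3) (q $ 4)]"

end

theory Submission
  imports Defs "HOL-Complex_Analysis.Cauchy_Integral_Formula"
begin

text \<open>
  Every partial derivative of a holomorphic function of several variables is holomorphic:
  by Taylor's formula and the Cauchy estimates on one-variable slices, the difference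
  quotients in a coordinate direction converge locally uniformly to the partial derivative,
  and locally uniform limits of holomorphic functions are holomorphic. Hence \<open>Re \<phi>\<close> is smooth,
  and the chain rule gives \<open>f\<^sub>1\<^sub>1 f\<^sub>2\<^sub>2 - f\<^sub>1\<^sub>2\<^sup>2 = - \<bar>\<phi>\<^sub>1\<^sub>1\<bar>\<^sup>2\<close> and
  \<open>f\<^sub>2\<^sub>4 - f\<^sub>1\<^sub>3 = - 2 Re \<phi>\<^sub>1\<^sub>2\<close>.
\<close>

section \<open>Partial derivatives\<close>

lemma axis_zero: "axis i 0 = 0"
  by (simp add: vec_eq_iff axis_def)

text \<open>Only one coordinate is nonzero, so bounding the Euclidean norm by the sum of the
  coordinate norms loses nothing. This keeps a slice over the disc of radius r inside the ball of
  radius r.\<close>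

lemma norm_axis_le: "norm (axis i x :: 'a::real_normed_vector ^ 'n) \<le> norm x"
proof -
  have "norm (axis i x :: 'a ^ 'n) \<le> (\<Sum>k\<in>UNIV. norm ((axis i x :: 'a ^ 'n) $ k))"
    unfolding norm_vec_def by (rule L2_set_le_sum) simp
  also have "\<dots> = (\<Sum>k\<in>UNIV. if k = i then norm x else 0)"
    by (rule sum.cong) (auto simp: axis_def)
  finally show ?thesis by simp
qed

lemma bounded_linear_axis: "bounded_linear (axis i :: 'a::real_normed_vector \<Rightarrow> 'a ^ 'n)"
proof (rule bounded_linear_intro)
  show "axis i (x + y) = axis i x + axis i y" for x y :: 'a
    by (simp add: vec_eq_iff axis_def)
  show "axis i (r *\<^sub>R x) = r *\<^sub>R axis i x" for r and x :: 'a
    by (simp add: vec_eq_iff axis_def)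
  show "norm (axis i x :: 'a ^ 'n) \<le> norm x * 1" for x :: 'a
    by (simp add: norm_axis_le)
qed

text \<open>Replacing a coordinate becomes an affine curve through \<open>x\<close>, to which the
  chain rule and continuity arguments apply via the bounded linear map
  \<open>axis i\<close>.\<close>

lemma partial_eq_deriv_axis:
  "partial i f x = deriv (\<lambda>t. f (x + axis i (t - x $ i))) (x $ i)"
proof -
  have "(\<chi> j. if j = i then t else x $ j) = x + axis i (t - x $ i)" for t
    by (auto simp: vec_eq_iff axis_def)
  then show ?thesis by (simp add: partial_def)
qed

text \<open>A Frechet derivative is only real linear, while \<open>deriv\<close> asks for
  multiplication by a field element. The second assumption supplies this along the i-th axis, so the
  lemma serves real and complex partial derivatives alike.\<close>

lemma partial_eqI:
  fixes f :: "'a::real_normed_field ^ 'n \<Rightarrow> 'a"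
  assumes "(f has_derivative f') (at x)" and "\<And>h. f' (axis i h) = c * h"
  shows "partial i f x = c"
proof -
  have 1: "((\<lambda>t. x + axis i (t - x $ i)) has_derivative axis i) (at (x $ i))"
    by (auto intro!: derivative_eq_intros bounded_linear.has_derivative[OF bounded_linear_axis])
  have "((\<lambda>t. f (x + axis i (t - x $ i))) has_derivative (\<lambda>h. f' (axis i h))) (at (x $ i))"
    using has_derivative_compose[OF 1, of f f'] assms(1)
    by (simp add: axis_zero)
  then have "((\<lambda>t. f (x + axis i (t - x $ i))) has_field_derivative c) (at (x $ i))"
    by (simp add: has_field_derivative_def assms(2))
  then show ?thesis
    unfolding partial_eq_deriv_axis by (rule DERIV_imp_deriv)
qed

text \<open>Meant for iterated partial derivatives, where the inner one is known in closed form only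
  on an open set.\<close>

lemma partial_cong:
  assumes "open S" "x \<in> S" "\<And>y. y \<in> S \<Longrightarrow> f y = g y"
  shows "partial i f x = partial i g x"
proof -
  have "isCont (\<lambda>t. x + axis i (t - x $ i)) (x $ i)"
    by (intro continuous_intros bounded_linear.isCont[OF bounded_linear_axis])
  \<comment> \<open>The filter is \<open>nhds\<close> rather than \<open>at\<close>, because
    \<open>deriv_cong_ev\<close> wants agreement at the point itself as well.\<close>
  then have "((\<lambda>t. x + axis i (t - x $ i)) \<longlongrightarrow> x) (nhds (x $ i))"
    by (simp add: axis_zero tendsto_nhds_iff isCont_def)
  then have "\<forall>\<^sub>F t in nhds (x $ i). x + axis i (t - x $ i) \<in> S"
    using assms(1,2) by (rule topological_tendstoD)
  then have "\<forall>\<^sub>F t in nhds (x $ i). f (x + axis i (t - x $ i)) = g (x + axis i (t - x $ i))"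
    by eventually_elim (rule assms(3))
  then show ?thesis
    unfolding partial_eq_deriv_axis by (rule deriv_cong_ev) simp
qed

section \<open>Holomorphic functions of several variables\<close>

lemma partial_eq_coeff:
  assumes "(\<phi> has_derivative (\<lambda>h. \<Sum>j\<in>UNIV. a j * h $ j)) (at z)"
  shows "partial i \<phi> z = (a i :: 'a::real_normed_field)"
  by (rule partial_eqI[OF assms]) (simp add: axis_def if_distrib cong: if_cong)

text \<open>The coefficient vector whose existence defines holomorphy is forced to consist of the
  partial derivatives, so it can be named from here on.\<close>

lemma holomorphic_vec_on_has_derivative:
  assumes "\<phi> holomorphic_vec_on U" "z \<in> U"
  shows "(\<phi> has_derivative (\<lambda>h. \<Sum>j\<in>UNIV. partial j \<phi> z * h $ j)) (at z)"
proof -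
  obtain a where a: "(\<phi> has_derivative (\<lambda>h. \<Sum>j\<in>UNIV. a $ j * h $ j)) (at z)"
    using assms unfolding holomorphic_vec_on_def by blast
  with partial_eq_coeff[OF a] show ?thesis by simp
qed

lemma holomorphic_vec_onI:
  assumes "\<And>z. z \<in> U \<Longrightarrow> (\<phi> has_derivative (\<lambda>h. \<Sum>j\<in>UNIV. a j z * h $ j)) (at z)"
  shows "\<phi> holomorphic_vec_on U"
  unfolding holomorphic_vec_on_def
proof
  show "\<exists>a. (\<phi> has_derivative (\<lambda>h. \<Sum>j\<in>UNIV. a $ j * h $ j)) (at z)" if "z \<in> U" for z
    using assms[OF that] by (intro exI[where x = "\<chi> j. a j z"]) simp
qed

lemma holomorphic_vec_on_subset:
  "\<phi> holomorphic_vec_on U \<Longrightarrow> V \<subseteq> U \<Longrightarrow> \<phi> holomorphic_vec_on V"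
  unfolding holomorphic_vec_on_def by blast

lemma holomorphic_vec_on_imp_continuous_on:
  assumes "\<phi> holomorphic_vec_on U"
  shows "continuous_on U \<phi>"
  using holomorphic_vec_on_has_derivative[OF assms]
  by (meson continuous_at_imp_continuous_on has_derivative_continuous)

lemma
  assumes "\<phi> holomorphic_vec_on U"
  shows holomorphic_vec_on_cmult: "(\<lambda>z. c * \<phi> z) holomorphic_vec_on U"
    and partial_cmult: "z \<in> U \<Longrightarrow> partial i (\<lambda>z. c * \<phi> z) z = c * partial i \<phi> z"
proof -
  have *: "((\<lambda>z. c * \<phi> z) has_derivative (\<lambda>h. \<Sum>j\<in>UNIV. (c * partial j \<phi> z) * h $ j)) (at z)"
    if "z \<in> U" for z
    using has_derivative_mult_right[OF holomorphic_vec_on_has_derivative[OF assms that]]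
    by (simp add: sum_distrib_left mult.assoc)
  from * show "(\<lambda>z. c * \<phi> z) holomorphic_vec_on U" by (rule holomorphic_vec_onI)
  show "partial i (\<lambda>z. c * \<phi> z) z = c * partial i \<phi> z" if "z \<in> U"
    using partial_eq_coeff[OF *[OF that]] .
qed

lemma
  assumes "\<phi> holomorphic_vec_on U" "\<psi> holomorphic_vec_on U"
  shows holomorphic_vec_on_diff: "(\<lambda>z. \<phi> z - \<psi> z) holomorphic_vec_on U"
    and partial_diff: "z \<in> U \<Longrightarrow> partial i (\<lambda>z. \<phi> z - \<psi> z) z = partial i \<phi> z - partial i \<psi> z"
proof -
  have *: "((\<lambda>z. \<phi> z - \<psi> z) has_derivative
      (\<lambda>h. \<Sum>j\<in>UNIV. (partial j \<phi> z - partial j \<psi> z) * h $ j)) (at z)" if "z \<in> U" for z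
    using has_derivative_diff[OF holomorphic_vec_on_has_derivative[OF assms(1) that]
        holomorphic_vec_on_has_derivative[OF assms(2) that]]
    by (simp add: sum_subtractf left_diff_distrib)
  from * show "(\<lambda>z. \<phi> z - \<psi> z) holomorphic_vec_on U" by (rule holomorphic_vec_onI)
  show "partial i (\<lambda>z. \<phi> z - \<psi> z) z = partial i \<phi> z - partial i \<psi> z" if "z \<in> U"
    using partial_eq_coeff[OF *[OF that]] .
qed

lemma holomorphic_vec_on_sum:
  assumes "\<And>k. k \<in> K \<Longrightarrow> \<phi> k holomorphic_vec_on U"
  shows "(\<lambda>z. \<Sum>k\<in>K. \<phi> k z) holomorphic_vec_on U"
proof (rule holomorphic_vec_onI)
  fix z assume "z \<in> U"
  have "((\<lambda>z. \<Sum>k\<in>K. \<phi> k z) has_derivative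
      (\<lambda>h. \<Sum>k\<in>K. \<Sum>j\<in>UNIV. partial j (\<phi> k) z * h $ j)) (at z)"
    by (intro has_derivative_sum holomorphic_vec_on_has_derivative[OF assms \<open>z \<in> U\<close>])
  then show "((\<lambda>z. \<Sum>k\<in>K. \<phi> k z) has_derivative
      (\<lambda>h. \<Sum>j\<in>UNIV. (\<Sum>k\<in>K. partial j (\<phi> k) z) * h $ j)) (at z)"
    by (subst (asm) sum.swap) (simp add: sum_distrib_right)
qed

lemma holomorphic_vec_on_shift:
  assumes "\<phi> holomorphic_vec_on U" "\<And>z. z \<in> V \<Longrightarrow> z + v \<in> U"
  shows "(\<lambda>z. \<phi> (z + v)) holomorphic_vec_on V"
proof (rule holomorphic_vec_onI)
  fix z assume "z \<in> V"
  have "((\<lambda>z. z + v) has_derivative (\<lambda>h. h)) (at z)"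
    by (auto intro!: derivative_eq_intros)
  from has_derivative_compose[OF this
      holomorphic_vec_on_has_derivative[OF assms(1) assms(2)[OF \<open>z \<in> V\<close>]]]
  show "((\<lambda>z. \<phi> (z + v)) has_derivative
      (\<lambda>h. \<Sum>j\<in>UNIV. partial j \<phi> (z + v) * h $ j)) (at z)" .
qed

section \<open>One-variable slices and Cauchy estimates\<close>

lemma slice_has_field_derivative:
  assumes "\<phi> holomorphic_vec_on U" "z + axis i t \<in> U"
  shows "((\<lambda>t. \<phi> (z + axis i t)) has_field_derivative partial i \<phi> (z + axis i t)) (at t)"
proof -
  have "((\<lambda>t. z + axis i t) has_derivative axis i) (at t)"
    by (auto intro!: derivative_eq_intros bounded_linear.has_derivative[OF bounded_linear_axis])
  from has_derivative_compose[OF this holomorphic_vec_on_has_derivative[OF assms]]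
  show ?thesis
    by (simp add: has_field_derivative_def axis_def if_distrib cong: if_cong)
qed

lemma axis_shift_mem_cball:
  "norm t \<le> r \<Longrightarrow> z + axis i t \<in> cball z r"
  using norm_axis_le[of i t] by (simp add: dist_norm)

lemma slice_holomorphic_on:
  assumes "\<phi> holomorphic_vec_on U" "cball z r \<subseteq> U"
  shows "(\<lambda>t. \<phi> (z + axis i t)) holomorphic_on cball 0 r"
proof -
  have "((\<lambda>t. \<phi> (z + axis i t)) has_field_derivative partial i \<phi> (z + axis i t))
      (at t within cball 0 r)" if "t \<in> cball 0 r" for t
  proof (rule has_field_derivative_at_within, rule slice_has_field_derivative[OF assms(1)])
    show "z + axis i t \<in> U"
      using that by (intro subsetD[OF assms(2)] axis_shift_mem_cball) simp
  qed
  then show ?thesis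
    unfolding holomorphic_on_def field_differentiable_def by blast
qed

text \<open>Cauchy's inequality for the first derivative of the slice through \<open>z\<close> in
  direction i, whose closed disc of radius r maps into \<open>cball z r\<close>.\<close>

lemma partial_Cauchy_estimate:
  assumes hol: "\<phi> holomorphic_vec_on U" and "cball z r \<subseteq> U" "0 < r"
    and B: "\<And>w. w \<in> cball z r \<Longrightarrow> norm (\<phi> w) \<le> B"
  shows "norm (partial i \<phi> z) \<le> B / r"
proof -
  let ?g = "\<lambda>t. \<phi> (z + axis i t)"
  have g: "?g holomorphic_on cball 0 r"
    by (rule slice_holomorphic_on) fact+
  have "norm ((deriv ^^ 1) ?g 0) \<le> fact 1 * B / r ^ 1"
  proof (rule Cauchy_inequality)
    show "?g holomorphic_on ball 0 r"
      using g ball_subset_cball by (rule holomorphic_on_subset)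
    show "continuous_on (cball 0 r) ?g"
      using g by (rule holomorphic_on_imp_continuous_on)
    show "norm (?g t) \<le> B" if "norm (0 - t) = r" for t
      using that by (intro B axis_shift_mem_cball) simp
  qed fact
  moreover have "z \<in> U" using assms(2) \<open>0 < r\<close> by auto
  then have "deriv ?g 0 = partial i \<phi> z"
    using slice_has_field_derivative[OF hol, of z i 0] by (simp add: axis_zero DERIV_imp_deriv)
  ultimately show ?thesis by simp
qed

text \<open>This is the first-order Taylor remainder of the slice, divided by \<open>t\<close>. The
  constant depends only on \<open>B\<close> and \<open>r\<close>, not on \<open>z\<close>, which
  makes the difference quotients converge uniformly.\<close>

lemma difference_quotient_bound:
  assumes hol: "\<phi> holomorphic_vec_on U" and sub: "cball z r \<subseteq> U" and "0 < r"
    and B: "\<And>w. w \<in> cball z r \<Longrightarrow> norm (\<phi> w) \<le> B"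
    and t: "norm t \<le> r / 2" "t \<noteq> 0"
  shows "norm (inverse t * (\<phi> (z + axis i t) - \<phi> z) - partial i \<phi> z) \<le> 8 * B / r\<^sup>2 * norm t"
proof -
  let ?g = "\<lambda>t. \<phi> (z + axis i t)"
  have g: "?g holomorphic_on cball 0 r"
    by (rule slice_holomorphic_on) fact+
  have gB: "norm ((deriv ^^ 2) ?g s) \<le> 8 * B / r\<^sup>2" if s: "s \<in> cball 0 (r / 2)" for s
  proof -
    have sub': "cball s (r / 2) \<subseteq> cball 0 r"
    proof
      fix u assume "u \<in> cball s (r / 2)"
      then show "u \<in> cball 0 r"
        using s norm_triangle_ineq[of s "u - s"] by (simp add: dist_norm norm_minus_commute)
    qed
    \<comment> \<open>A disc of radius r/2 about a point with norm at most r/2 stays in the disc of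
      radius r, so Cauchy's inequality gives 2! B / (r/2)^2 = 8 B / r^2.\<close>
    have "norm ((deriv ^^ 2) ?g s) \<le> fact 2 * B / (r / 2) ^ 2"
    proof (rule Cauchy_inequality)
      show "norm (?g u) \<le> B" if "norm (s - u) = r / 2" for u
      proof -
        have "u \<in> cball 0 r" using that sub' by (auto simp: dist_norm)
        then show ?thesis by (intro B axis_shift_mem_cball) simp
      qed
      show "continuous_on (cball s (r / 2)) ?g"
        using g sub' by (blast intro: holomorphic_on_subset holomorphic_on_imp_continuous_on)
      show "?g holomorphic_on ball s (r / 2)"
        using g sub' ball_subset_cball by (blast intro: holomorphic_on_subset)
    qed (use \<open>0 < r\<close> in simp)
    then show ?thesis by (simp add: field_simps power2_eq_square)
  qed
  have "((deriv ^^ k) ?g has_field_derivative (deriv ^^ Suc k) ?g s) (at s within cball 0 (r / 2))"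
    if s: "s \<in> cball 0 (r / 2)" for k s
  proof -
    have "(deriv ^^ k) ?g holomorphic_on ball 0 r"
      using holomorphic_on_subset[OF g ball_subset_cball] by (rule holomorphic_higher_deriv) simp
    moreover have "s \<in> ball 0 r" using s \<open>0 < r\<close> by auto
    ultimately show ?thesis
      using holomorphic_derivI[of "(deriv ^^ k) ?g" "ball 0 r" s] by simp
  qed
  \<comment> \<open>In \<open>complex_Taylor\<close> the remainder of order n is divided by n!, not
    (n+1)!, so for n = 1 the constant 8 B / r^2 is unchanged.\<close>
  then have "norm ((deriv ^^ 0) ?g t - (\<Sum>k\<le>1. (deriv ^^ k) ?g 0 * (t - 0) ^ k / fact k))
      \<le> 8 * B / r\<^sup>2 * norm (t - 0) ^ Suc 1 / fact 1"
    using gB t \<open>0 < r\<close>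
    by (intro complex_Taylor[where S = "cball 0 (r / 2)"]) (auto simp: numeral_2_eq_2)
  moreover have "z \<in> U" using sub \<open>0 < r\<close> by auto
  then have "deriv ?g 0 = partial i \<phi> z"
    using slice_has_field_derivative[OF hol, of z i 0] by (simp add: axis_zero DERIV_imp_deriv)
  ultimately have "norm (\<phi> (z + axis i t) - \<phi> z - partial i \<phi> z * t) \<le> 8 * B / r\<^sup>2 * norm t ^ 2"
    by (simp add: axis_zero numeral_2_eq_2 diff_diff_eq)
  then have "norm (inverse t) * norm (\<phi> (z + axis i t) - \<phi> z - partial i \<phi> z * t)
      \<le> norm (inverse t) * (8 * B / r\<^sup>2 * norm t ^ 2)"
    by (rule mult_left_mono) simp
  moreover have "inverse t * (\<phi> (z + axis i t) - \<phi> z - partial i \<phi> z * t)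
      = inverse t * (\<phi> (z + axis i t) - \<phi> z) - partial i \<phi> z"
    using t by (simp add: algebra_simps)
  moreover have "norm (inverse t) * (8 * B / r\<^sup>2 * norm t ^ 2) = 8 * B / r\<^sup>2 * norm t"
    using t unfolding norm_inverse power2_eq_square by (simp add: field_simps)
  ultimately show ?thesis
    by (metis norm_mult)
qed

section \<open>Uniform limits and holomorphy of the partial derivatives\<close>

text \<open>By the Cauchy estimate, the partial derivatives of the sequence are uniformly Cauchy on
  a smaller ball. Differentiating the limit then yields a derivative with the limit coefficients,
  which is again complex linear.\<close>

lemma holomorphic_vec_on_uniform_limit:
  assumes "open S" and hol: "\<And>n. f n holomorphic_vec_on S"
    and lim: "uniform_limit S f g sequentially"
  shows "g holomorphic_vec_on S"
  unfolding holomorphic_vec_on_def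
proof
  fix z0 assume "z0 \<in> S"
  then obtain r' where r': "0 < r'" "cball z0 r' \<subseteq> S"
    using \<open>open S\<close> open_contains_cball by blast
  define r where "r = r' / 2"
  define T where "T = ball z0 r"
  have "0 < r" using r' by (simp add: r_def)
  have sub: "cball z r \<subseteq> S" if "z \<in> T" for z
  proof
    fix w assume "w \<in> cball z r"
    then have "dist z0 w \<le> r'"
      using that dist_triangle[of z0 w z] by (simp add: T_def r_def)
    then show "w \<in> S" using r' by auto
  qed
  have T: "T \<subseteq> S"
  proof
    fix x assume "x \<in> T"
    then show "x \<in> S" using sub[of x] \<open>0 < r\<close> by auto
  qed
  have "uniformly_Cauchy_on T (\<lambda>n. partial j (f n))" for j
    unfolding uniformly_Cauchy_on_def
  proof (intro allI impI)
    fix e :: real assume "0 < e"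
    have "uniformly_Cauchy_on S f"
      using lim uniformly_convergent_Cauchy unfolding uniformly_convergent_on_def by blast
    \<comment> \<open>The Cauchy estimate divides by r and yields only a weak inequality; the
      tolerance (e/2) r thus leaves e/2, strictly below e.\<close>
    then obtain N where N: "\<And>m n x. m \<ge> N \<Longrightarrow> n \<ge> N \<Longrightarrow> x \<in> S \<Longrightarrow> dist (f m x) (f n x) < e / 2 * r"
      unfolding uniformly_Cauchy_on_def using \<open>0 < e\<close> \<open>0 < r\<close>
      by (metis half_gt_zero mult_pos_pos)
    have "dist (partial j (f m) x) (partial j (f n) x) < e" if "x \<in> T" "m \<ge> N" "n \<ge> N" for x m n
    proof -
      have "norm (partial j (\<lambda>z. f m z - f n z) x) \<le> (e / 2 * r) / r"
      proof (rule partial_Cauchy_estimate[OF holomorphic_vec_on_diff[OF hol hol] sub[OF \<open>x \<in> T\<close>] \<open>0 < r\<close>])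
        show "norm (f m w - f n w) \<le> e / 2 * r" if "w \<in> cball x r" for w
          using N[OF \<open>m \<ge> N\<close> \<open>n \<ge> N\<close>, of w] sub[OF \<open>x \<in> T\<close>] that by (auto simp: dist_norm)
      qed
      also have "\<dots> < e" using \<open>0 < e\<close> \<open>0 < r\<close> by simp
      finally show ?thesis
        using that T by (simp add: partial_diff[OF hol hol] subsetD dist_norm)
    qed
    then show "\<exists>M. \<forall>x\<in>T. \<forall>m\<ge>M. \<forall>n\<ge>M. dist (partial j (f m) x) (partial j (f n) x) < e"
      by blast
  qed
  then have "\<forall>j. \<exists>b. uniform_limit T (\<lambda>n. partial j (f n)) b sequentially"
    using Cauchy_uniformly_convergent unfolding uniformly_convergent_on_def by blast
  then obtain b where b: "\<And>j. uniform_limit T (\<lambda>n. partial j (f n)) (b j) sequentially"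
    by metis
  have "\<exists>h. \<forall>x\<in>T. (\<lambda>n. f n x) \<longlonglongrightarrow> h x \<and>
      (h has_derivative (\<lambda>v. \<Sum>j\<in>UNIV. b j x * v $ j)) (at x within T)"
  proof (rule has_derivative_sequence)
    show "convex T" "z0 \<in> T" using \<open>0 < r\<close> by (auto simp: T_def)
    show "(f n has_derivative (\<lambda>v. \<Sum>j\<in>UNIV. partial j (f n) x * v $ j)) (at x within T)"
      if "x \<in> T" for n x
      using holomorphic_vec_on_has_derivative[OF hol subsetD[OF T that]]
      by (rule has_derivative_at_withinI)
    show "(\<lambda>n. f n z0) \<longlonglongrightarrow> g z0"
      using tendsto_uniform_limitI[OF lim \<open>z0 \<in> S\<close>] .
    fix e :: real assume "0 < e"
    let ?N = "real CARD('a)"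
    \<comment> \<open>Each coefficient gets the share e/N, so that the sum over the N coordinates
      stays within e times the norm of the direction.\<close>
    have "\<forall>\<^sub>F n in sequentially. \<forall>j\<in>UNIV. \<forall>x\<in>T. dist (partial j (f n) x) (b j x) < e / ?N"
      using b \<open>0 < e\<close> unfolding uniform_limit_iff
      by (intro eventually_ball_finite) auto
    then show "\<forall>\<^sub>F n in sequentially. \<forall>x\<in>T. \<forall>h. norm ((\<Sum>j\<in>UNIV. partial j (f n) x * h $ j)
        - (\<Sum>j\<in>UNIV. b j x * h $ j)) \<le> e * norm h"
    proof eventually_elim
      case (elim n)
      show ?case
      proof (intro ballI allI)
        fix x h assume "x \<in> T"
        have "norm ((\<Sum>j\<in>UNIV. partial j (f n) x * h $ j) - (\<Sum>j\<in>UNIV. b j x * h $ j))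
            = norm (\<Sum>j\<in>UNIV. (partial j (f n) x - b j x) * h $ j)"
          by (simp add: sum_subtractf left_diff_distrib)
        also have "\<dots> \<le> (\<Sum>j\<in>(UNIV::'a set). e / ?N * norm h)"
        proof (rule sum_norm_le)
          fix j
          show "norm ((partial j (f n) x - b j x) * h $ j) \<le> e / ?N * norm h"
            unfolding norm_mult using elim \<open>x \<in> T\<close> \<open>0 < e\<close>
            by (intro mult_mono Finite_Cartesian_Product.norm_nth_le)
              (auto simp: dist_norm intro: less_imp_le)
        qed
        also have "\<dots> = e * norm h" by simp
        finally show "norm ((\<Sum>j\<in>UNIV. partial j (f n) x * h $ j) - (\<Sum>j\<in>UNIV. b j x * h $ j))
            \<le> e * norm h" .
      qed
    qed
  qed
  then obtain h where h: "\<And>x. x \<in> T \<Longrightarrow> (\<lambda>n. f n x) \<longlonglongrightarrow> h x"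
    "\<And>x. x \<in> T \<Longrightarrow> (h has_derivative (\<lambda>v. \<Sum>j\<in>UNIV. b j x * v $ j)) (at x within T)"
    by blast
  \<comment> \<open>\<open>has_derivative_sequence\<close> produces its own limit function;
    uniqueness of pointwise limits identifies it with \<open>g\<close> on \<open>T\<close>.\<close>
  have hg: "h x = g x" if "x \<in> T" for x
    using LIMSEQ_unique[OF h(1)[OF that] tendsto_uniform_limitI[OF lim]] that T by blast
  have T0: "z0 \<in> T" "open T" using \<open>0 < r\<close> by (auto simp: T_def)
  have "(h has_derivative (\<lambda>v. \<Sum>j\<in>UNIV. b j z0 * v $ j)) (at z0)"
    using h(2)[OF T0(1)] unfolding at_within_open[OF T0] .
  then have "(g has_derivative (\<lambda>v. \<Sum>j\<in>UNIV. b j z0 * v $ j)) (at z0)"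
    by (rule has_derivative_transform_within_open) (fact T0 hg)+
  then show "\<exists>a. (g has_derivative (\<lambda>h. \<Sum>j\<in>UNIV. a $ j * h $ j)) (at z0)"
    by (intro exI[where x = "\<chi> j. b j z0"]) simp
qed

text \<open>Holomorphy is local, so it suffices to exhibit the partial derivative near each point as
  a uniform limit of holomorphic functions. Difference quotients with fixed increments are such
  functions.\<close>

lemma holomorphic_vec_on_partial:
  assumes "open U" and hol: "\<phi> holomorphic_vec_on U"
  shows "partial i \<phi> holomorphic_vec_on U"
proof -
  have "\<exists>a. (partial i \<phi> has_derivative (\<lambda>h. \<Sum>j\<in>UNIV. a $ j * h $ j)) (at z0)"
    if "z0 \<in> U" for z0
  proof -
    obtain r' where r': "0 < r'" "cball z0 r' \<subseteq> U"
      using \<open>open U\<close> \<open>z0 \<in> U\<close> open_contains_cball by blast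
    define r where "r = r' / 2"
    have "0 < r" using r' by (simp add: r_def)
    \<comment> \<open>Compactness gives one bound \<open>B\<close> for all the balls
      \<open>cball z r\<close> with centre in \<open>ball z0 r\<close>, hence an error estimate
      uniform in the centre.\<close>
    have "bounded (\<phi> ` cball z0 r')"
      using continuous_on_subset[OF holomorphic_vec_on_imp_continuous_on[OF hol] r'(2)]
      by (intro compact_imp_bounded compact_continuous_image) simp_all
    then obtain B where "\<forall>w\<in>\<phi> ` cball z0 r'. norm w \<le> B"
      unfolding bounded_iff by blast
    then have B: "norm (\<phi> w) \<le> B" if "w \<in> cball z0 r'" for w
      using that by blast
    have cball_sub: "cball z r \<subseteq> cball z0 r'" if "z \<in> ball z0 r" for z
    proof
      fix w assume "w \<in> cball z r"
      then show "w \<in> cball z0 r'"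
        using that dist_triangle[of z0 w z] by (simp add: r_def)
    qed
    have "ball z0 r \<subseteq> cball z0 r'" using \<open>0 < r\<close> by (auto simp: r_def)
    with r' have ball_sub: "ball z0 r \<subseteq> U" by blast
    \<comment> \<open>The increments tend to 0, are nonzero and have norm at most r/2, as
      \<open>difference_quotient_bound\<close> requires.\<close>
    define t where "t = (\<lambda>n. complex_of_real (r / 2 / real (Suc n)))"
    have t: "norm (t n) = r / 2 / real (Suc n)" "norm (t n) \<le> r / 2" "t n \<noteq> 0" for n
    proof -
      show "norm (t n) = r / 2 / real (Suc n)"
        using \<open>0 < r\<close> unfolding t_def norm_of_real by simp
      then show "norm (t n) \<le> r / 2"
        using frac_le[of "r / 2" "r / 2" 1 "real (Suc n)"] \<open>0 < r\<close> by simp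
      show "t n \<noteq> 0" using \<open>0 < r\<close> unfolding t_def of_real_eq_0_iff by simp
    qed
    define f where "f = (\<lambda>n z. inverse (t n) * (\<phi> (z + axis i (t n)) - \<phi> z))"
    have "f n holomorphic_vec_on ball z0 r" for n
      unfolding f_def
    proof (intro holomorphic_vec_on_cmult holomorphic_vec_on_diff)
      show "\<phi> holomorphic_vec_on ball z0 r"
        using hol ball_sub by (rule holomorphic_vec_on_subset)
      show "(\<lambda>z. \<phi> (z + axis i (t n))) holomorphic_vec_on ball z0 r"
      proof (rule holomorphic_vec_on_shift[OF hol])
        fix z assume "z \<in> ball z0 r"
        moreover have "z + axis i (t n) \<in> cball z r"
          using t(2)[of n] \<open>0 < r\<close> by (intro axis_shift_mem_cball) simp
        ultimately show "z + axis i (t n) \<in> U"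
          using cball_sub r' by blast
      qed
    qed
    moreover have "uniform_limit (ball z0 r) f (partial i \<phi>) sequentially"
    proof (rule uniform_limitI)
      fix e :: real assume "0 < e"
      have "(\<lambda>n. 8 * B / r\<^sup>2 * (r / 2 / real (Suc n))) \<longlonglongrightarrow> 8 * B / r\<^sup>2 * 0"
        using LIMSEQ_Suc[OF lim_const_over_n[of "r / 2"]] by (intro tendsto_mult_left)
      then have "\<forall>\<^sub>F n in sequentially. 8 * B / r\<^sup>2 * (r / 2 / real (Suc n)) < e"
        using \<open>0 < e\<close> by (auto dest: order_tendstoD(2))
      then show "\<forall>\<^sub>F n in sequentially. \<forall>z\<in>ball z0 r. dist (f n z) (partial i \<phi> z) < e"
      proof eventually_elim
        case (elim n)
        show ?case
        proof
          fix z assume "z \<in> ball z0 r"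
          then have "cball z r \<subseteq> cball z0 r'" by (rule cball_sub)
          then have "norm (f n z - partial i \<phi> z) \<le> 8 * B / r\<^sup>2 * norm (t n)"
            unfolding f_def using r' B t[of n] \<open>0 < r\<close>
            by (intro difference_quotient_bound[OF hol]) auto
          with elim show "dist (f n z) (partial i \<phi> z) < e"
            unfolding t(1) dist_norm by linarith
        qed
      qed
    qed
    ultimately have "partial i \<phi> holomorphic_vec_on ball z0 r"
      by (rule holomorphic_vec_on_uniform_limit[OF open_ball])
    then show ?thesis
      using \<open>0 < r\<close> by (auto simp: holomorphic_vec_on_def)
  qed
  then show ?thesis
    by (simp add: holomorphic_vec_on_def)
qed

section \<open>Composition with real linear maps\<close>

text \<open>Having a given Frechet derivative at a point of an open set depends only on the values
  in that set. This allows \<open>frechet_derivative\<close> to be replaced under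
  \<open>C_on\<close> by a formula valid only on the set.\<close>

lemma C_on_cong:
  assumes "open S" "\<And>x. x \<in> S \<Longrightarrow> f x = g x"
  shows "C_on n S f \<longleftrightarrow> C_on n S g"
  using assms(2)
proof (induction n arbitrary: f g)
  case 0
  then show ?case by (simp cong: continuous_on_cong)
next
  case (Suc n)
  have D: "(f has_derivative d) (at x) \<longleftrightarrow> (g has_derivative d) (at x)" if "x \<in> S" for d x
    using has_derivative_transform_within_open[OF _ \<open>open S\<close> that, of f d UNIV g]
      has_derivative_transform_within_open[OF _ \<open>open S\<close> that, of g d UNIV f] Suc.prems
    by auto
  have "frechet_derivative f (at x) v = frechet_derivative g (at x) v" if "x \<in> S" for x v
    by (simp add: frechet_derivative_def D[OF that])
  then have "C_on n S (\<lambda>x. frechet_derivative f (at x) v)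
      \<longleftrightarrow> C_on n S (\<lambda>x. frechet_derivative g (at x) v)" for v
    by (rule Suc.IH)
  moreover have "f differentiable (at x) \<longleftrightarrow> g differentiable (at x)" if "x \<in> S" for x
    by (simp add: differentiable_def D[OF that])
  ultimately show ?case by simp
qed

lemma has_derivative_linear_comp_holomorphic:
  assumes "bounded_linear P" "bounded_linear L" "\<phi> holomorphic_vec_on U" "L q \<in> U"
  shows "((\<lambda>q. P (\<phi> (L q))) has_derivative
           (\<lambda>v. P (\<Sum>j\<in>UNIV. partial j \<phi> (L q) * L v $ j))) (at q)"
  using has_derivative_compose[OF bounded_linear_imp_has_derivative[OF assms(2)]
      holomorphic_vec_on_has_derivative[OF assms(3,4)]]
  by (rule bounded_linear.has_derivative[OF assms(1)])

text \<open>The functions of this shape are closed under directional differentiation: in direction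
  v, \<phi> is replaced by the combination of its partial derivatives with the constant coefficients
  \<open>L v $ j\<close>, which is again holomorphic. Hence the induction over n with \<phi>
  arbitrary.\<close>

lemma C_on_linear_comp_holomorphic:
  fixes L :: "'a::euclidean_space \<Rightarrow> complex ^ 'n"
  assumes P: "bounded_linear P" and L: "bounded_linear L" and "open U" "\<phi> holomorphic_vec_on U"
  shows "C_on n (L -` U) (\<lambda>q. P (\<phi> (L q)))"
  using assms(4)
proof (induction n arbitrary: \<phi>)
  case 0
  show ?case
    using has_derivative_linear_comp_holomorphic[OF P L 0]
    by (auto intro!: continuous_at_imp_continuous_on intro: has_derivative_continuous)
next
  case (Suc n)
  note D = has_derivative_linear_comp_holomorphic[OF P L Suc.prems]
  have "open (L -` U)"
    using \<open>open U\<close> L by (intro open_vimage) (auto intro: linear_continuous_on)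
  moreover have "C_on n (L -` U) (\<lambda>q. P (\<Sum>j\<in>UNIV. L v $ j * partial j \<phi> (L q)))" for v
    by (intro Suc.IH holomorphic_vec_on_sum holomorphic_vec_on_cmult
        holomorphic_vec_on_partial \<open>open U\<close> Suc.prems)
  moreover have "frechet_derivative (\<lambda>q. P (\<phi> (L q))) (at q) v
      = P (\<Sum>j\<in>UNIV. L v $ j * partial j \<phi> (L q))" if "q \<in> L -` U" for q v
    using frechet_derivative_at[OF D, of q] that by (simp add: mult.commute fun_eq_iff)
  ultimately have "C_on n (L -` U) (\<lambda>q. frechet_derivative (\<lambda>q. P (\<phi> (L q))) (at q) v)" for v
    by (subst C_on_cong) auto
  moreover have "(\<lambda>q. P (\<phi> (L q))) differentiable (at q)" if "q \<in> L -` U" for q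
    using D[of q] that by (auto simp: differentiable_def)
  ultimately show ?case by simp
qed

section \<open>Real partial derivatives of the real part\<close>

text \<open>The last assumption says that \<open>L\<close> sends the k-th real direction into the
  j-th complex coordinate line with factor \<open>c\<close>; for \<open>to_C2\<close> the factor is
  1 or \<i>. Complex linearity of the derivative then pulls \<open>c\<close> out.\<close>

lemma partial_Re_comp:
  fixes L :: "real ^ 'm \<Rightarrow> complex ^ 'n"
  assumes L: "bounded_linear L" and hol: "\<phi> holomorphic_vec_on U" and "L q \<in> U"
    and k: "L (axis k 1) = axis j c"
  shows "partial k (\<lambda>q. Re (\<phi> (L q))) q = Re (c * partial j \<phi> (L q))"
proof (rule partial_eqI)
  show "((\<lambda>q. Re (\<phi> (L q))) has_derivative
      (\<lambda>v. Re (\<Sum>j\<in>UNIV. partial j \<phi> (L q) * L v $ j))) (at q)"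
    by (rule has_derivative_linear_comp_holomorphic[OF bounded_linear_Re]) fact+
  fix h :: real
  have "axis k h = h *\<^sub>R (axis k 1 :: real ^ 'm)"
    by (simp add: vec_eq_iff axis_def)
  then have "L (axis k h) = h *\<^sub>R axis j c"
    using L k by (simp add: linear_simps)
  then have "(\<Sum>j\<in>UNIV. partial j \<phi> (L q) * L (axis k h) $ j) = h *\<^sub>R (c * partial j \<phi> (L q))"
    by (simp add: axis_def if_distrib mult.commute cong: if_cong)
  then show "Re (\<Sum>j\<in>UNIV. partial j \<phi> (L q) * L (axis k h) $ j)
      = Re (c * partial j \<phi> (L q)) * h"
    by (simp add: mult.commute)
qed

text \<open>The first differentiation gives the real part of the holomorphic function c'
  \<partial>\<phi>/\<partial>z_j' composed with \<open>L\<close>, so the first-order formula applies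
  again. That inner formula holds only on the preimage of \<open>U\<close>, whence
  \<open>partial_cong\<close>.\<close>

lemma partial_partial_Re_comp:
  fixes L :: "real ^ 'm \<Rightarrow> complex ^ 'n"
  assumes L: "bounded_linear L" and "open U" and hol: "\<phi> holomorphic_vec_on U" and q: "L q \<in> U"
    and k: "L (axis k 1) = axis j c" and k': "L (axis k' 1) = axis j' c'"
  shows "partial k (partial k' (\<lambda>q. Re (\<phi> (L q)))) q = Re (c * (c' * partial j (partial j' \<phi>) (L q)))"
proof -
  have hol': "partial j' \<phi> holomorphic_vec_on U"
    by (rule holomorphic_vec_on_partial) fact+
  have "open (L -` U)"
    using \<open>open U\<close> L by (intro open_vimage) (auto intro: linear_continuous_on)
  then have "partial k (partial k' (\<lambda>q. Re (\<phi> (L q)))) q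
      = partial k (\<lambda>q. Re (c' * partial j' \<phi> (L q))) q"
    using q partial_Re_comp[OF L hol _ k'] by (intro partial_cong[of "L -` U"]) blast+
  also have "\<dots> = Re (c * partial j (\<lambda>z. c' * partial j' \<phi> z) (L q))"
    by (rule partial_Re_comp[OF L holomorphic_vec_on_cmult[OF hol'] q k])
  finally show ?thesis
    by (simp add: partial_cmult[OF hol' q])
qed

section \<open>The identification of R^4 with C^2 and the Plebanski II equation\<close>

lemma bounded_linear_to_C2: "bounded_linear to_C2"
proof -
  have "linear to_C2"
    by (rule linearI) (simp_all add: to_C2_def vec_eq_iff forall_2 complex_eq_iff)
  then show ?thesis by (simp add: linear_conv_bounded_linear)
qed

lemma to_C2_axis:
  "to_C2 (axis 1 1) = axis 1 1" "to_C2 (axis 2 1) = axis 1 \<i>"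
  "to_C2 (axis 3 1) = axis 2 1" "to_C2 (axis 4 1) = axis 2 \<i>"
  by (simp_all add: to_C2_def vec_eq_iff forall_2 axis_def complex_eq_iff)

theorem proposition7:
  fixes \<phi> :: "complex ^ 2 \<Rightarrow> complex" and U :: "(complex ^ 2) set"
  assumes "open U"
    and "\<phi> holomorphic_vec_on U"
    and "\<And>z. z \<in> U \<Longrightarrow>
           partial 1 (partial 2 \<phi>) z + cnj (partial 1 (partial 2 \<phi>) z)
           + complex_of_real ((cmod (partial 1 (partial 1 \<phi>) z))\<^sup>2) = 0"
  shows "plebanski_II_regular_solution (\<lambda>q. Re (\<phi> (to_C2 q))) (to_C2 -` U)"
  unfolding plebanski_II_regular_solution_def smooth_on_def
proof (intro conjI allI ballI)
  show "open (to_C2 -` U)"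
    using \<open>open U\<close> bounded_linear_to_C2
    by (intro open_vimage) (auto intro: linear_continuous_on)
  show "C_on n (to_C2 -` U) (\<lambda>q. Re (\<phi> (to_C2 q)))" for n
    by (rule C_on_linear_comp_holomorphic[OF bounded_linear_Re bounded_linear_to_C2 assms(1,2)])
  fix q assume "q \<in> to_C2 -` U"
  then have q: "to_C2 q \<in> U" by simp
  note second = partial_partial_Re_comp[OF bounded_linear_to_C2 assms(1,2) q]
  let ?f = "\<lambda>q. Re (\<phi> (to_C2 q))"
  define a where "a = partial 1 (partial 1 \<phi>) (to_C2 q)"
  define b where "b = partial 1 (partial 2 \<phi>) (to_C2 q)"
  \<comment> \<open>The left-hand side of the hypothesis is real, so taking real parts loses
    nothing.\<close>
  have "Re (b + cnj b + complex_of_real ((cmod a)\<^sup>2)) = 0"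
    using assms(3)[OF q] by (simp add: a_def b_def)
  then have "2 * Re b + (Re a)\<^sup>2 + (Im a)\<^sup>2 = 0"
    by (simp add: cmod_power2)
  \<comment> \<open>The five values differ by the product of the two direction factors: 1 gives the
    real part, \<i>\<i> its negative, and a single \<i> minus the imaginary part.\<close>
  moreover have "partial 1 (partial 1 ?f) q = Re a"
    using second[OF to_C2_axis(1) to_C2_axis(1)] by (simp add: a_def)
  moreover have "partial 2 (partial 2 ?f) q = - Re a"
    using second[OF to_C2_axis(2) to_C2_axis(2)] by (simp add: a_def)
  moreover have "partial 1 (partial 2 ?f) q = - Im a"
    using second[OF to_C2_axis(1) to_C2_axis(2)] by (simp add: a_def)
  moreover have "partial 2 (partial 4 ?f) q = - Re b"
    using second[OF to_C2_axis(2) to_C2_axis(4)] by (simp add: b_def)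
  moreover have "partial 1 (partial 3 ?f) q = Re b"
    using second[OF to_C2_axis(1) to_C2_axis(3)] by (simp add: b_def)
  \<comment> \<open>After substitution the left-hand side is -(Re a)^2 - (Im a)^2 - 2 Re b, the
    negative of the real equation above.\<close>
  ultimately show "partial 1 (partial 1 ?f) q * partial 2 (partial 2 ?f) q
      - (partial 1 (partial 2 ?f) q)\<^sup>2 + partial 2 (partial 4 ?f) q - partial 1 (partial 3 ?f) q = 0"
    by (simp add: power2_eq_square)
qed

end
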